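(* Let $M$ be the McLain group of a non-empty totally ordered set $(\Lambda,\leq)$ over a ring $R$ with $1\neq0$, let $F$ be a field such that $R$ admits a right primitive linear character $R^+\to F^*$, let $D$ be a basic subset of $\Phi$ and $f$ a function from $D$ into the set of right primitive linear characters $R^+\to F^*$. With $\Gamma_1$, $\Omega$, $H\leq I\leq M$ and $\lambda:H\to F^*$ associated to $(D,f)$ as in the context, the following conditions are equivalent: (a) $\lambda$ is extendible to $I$ (i.e. there is a group homomorphism $I\to F^*$ whose restriction to $H$ is $\lambda$). (b) $[\Gamma_1,\Gamma_1]\cap D=\emptyset$. (c) $[\Omega,\Omega]\cap D=\emptyset$. (d) $D$ has no special triple.
   Context: McLain group: $\Phi=\{(\alpha,\beta)\in\Lambda\times\Lambda:\alpha<\beta\}$. $J$ is the free left $R$-module with basis $e_{\alpha\beta}$, $(\alpha,\beta)\in\Phi$ ($R$ not necessarily commutative or finite), made into a ring by $(re_{\alpha\beta})(se_{\beta\gamma})=rs\,e_{\alpha\gamma}$ and $(re_{\alpha\beta})(se_{\gamma\delta})=0$ if $\beta\neq\gamma$, extended additively. $J$ is nil, and $M=\{1+x:x\in J\}$ is a group under multiplication. $M_{\alpha\beta}=\{1+re_{\alpha\beta}:r\in R\}$. A subset $\Delta\subseteq\Phi$ is closed if $(\alpha,\beta),(\beta,\gamma)\in\Delta$ implies $(\alpha,\gamma)\in\Delta$; then $M(\Delta)=\langle M_{\alpha\beta}:(\alpha,\beta)\in\Delta\rangle$. For $\Delta\subseteq\Phi$, $[\Delta,\Delta]$ is the set of all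 $(\alpha,\beta)\in\Phi$ for which there is a chain $(\gamma_1,\gamma_2),(\gamma_2,\gamma_3),\dots,(\gamma_{n-1},\gamma_n)\in\Delta$ with $n\geq3$, $\gamma_1=\alpha$, $\gamma_n=\beta$. A group homomorphism $R^+\to F^*$ (linear character) is right primitive if the only right ideal of $R$ contained in its kernel is $(0)$. A finite non-empty subset $D=\{(\alpha_1,\beta_1),\dots,(\alpha_m,\beta_m)\}$ of $\Phi$ is basic if the $\alpha_i$ are distinct and the $\beta_i$ are distinct. Write $f(\alpha_i,\beta_i)=\lambda_i$. Notation attached to $(D,f)$: $\Gamma=\Phi\setminus\bigcup_i\{(\alpha_i,\gamma)\in\Phi:\gamma<\beta_i\}$ and $H=M(\Gamma)$. For each $i$, $H_i=M(\Phi\setminus\{(\alpha_i,\gamma)\in\Phi:\gamma<\beta_i\})$ and $\widehat{\lambda_i}:H_i\to F^*$ is the homomorphism with $1+re_{\alpha_i\beta_i}\mapsto\lambda_i(r)$ that is trivial on all $M_{\alpha\beta}$ with $(\alpha,\beta)\in\Phi\setminus\{(\alpha_i,\gamma)\in\Phi:\gamma\le\beta_i\}$. Then $H=\bigcap_iH_i$ and $\lambda=\widehat{\lambda_1}|_H\cdots\widehat{\lambda_m}|_H:H\to F^*$. $\Omega=\{(\alpha,\gamma)\in\Phi:\exists\,(\alpha,\beta),(\gamma,\delta)\in D\text{ with }\alpha<\gamma<\beta<\delta\}$, $\Gamma_1=\Gamma\cup\Omega$ (a closed subset of $\Phi$), and $I=M(\Gamma_1)$. $D$ has a special triple if it contains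 three elements $(a_1,b_1),(a_2,b_2),(a_3,b_3)$ with $a_1<a_2<a_3=b_1<b_2<b_3$. *)

theory Defs
  imports "HOL-Algebra.Generated_Groups" "HOL-Algebra.Multiplicative_Group"
    "HOL-Algebra.Algebraic_Closure_Type"
begin

section \<open>The McLain group\<close>

text \<open>
  The totally ordered set \<open>\<Lambda>\<close> is a type \<open>'l\<close> of class \<open>linorder\<close>, the ring \<open>R\<close> (not necessarily
  commutative, with \<open>1 \<noteq> 0\<close>) a type \<open>'r\<close> of class \<open>ring_1\<close>, and \<open>F\<close> a type \<open>'f\<close> of class \<open>field\<close>.
  An element of the free module \<open>J\<close> is given by its coefficient function, i.e. as a
  \<open>\<Lambda> \<times> \<Lambda>\<close> matrix over \<open>R\<close>; the formal \<open>1\<close> in \<open>1 + x\<close> is the identity matrix.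
\<close>

definition Phi :: "('l::linorder \<times> 'l) set" where
  "Phi = {(a, b). a < b}"

definition support :: "('l \<Rightarrow> 'l \<Rightarrow> 'r::zero) \<Rightarrow> ('l \<times> 'l) set" where
  "support x = {(a, b). x a b \<noteq> 0}"

definition J :: "('l::linorder \<Rightarrow> 'l \<Rightarrow> 'r::ring_1) set" where
  "J = {x. finite (support x) \<and> support x \<subseteq> Phi}"

definition elem_mat :: "'r::ring_1 \<Rightarrow> 'l \<Rightarrow> 'l \<Rightarrow> ('l \<Rightarrow> 'l \<Rightarrow> 'r)" where
  "elem_mat r a b = (\<lambda>c d. if c = a \<and> d = b then r else 0)"

text \<open>
  The index set of the sum is finite whenever the left factor has finite rows, hence for all
  factors in \<open>J\<close> or of the form \<open>1 + x\<close> with \<open>x \<in> J\<close>.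
\<close>

definition mat_mult ::
    "('l \<Rightarrow> 'l \<Rightarrow> 'r::ring_1) \<Rightarrow> ('l \<Rightarrow> 'l \<Rightarrow> 'r) \<Rightarrow> ('l \<Rightarrow> 'l \<Rightarrow> 'r)" where
  "mat_mult x y = (\<lambda>a c. \<Sum>b | x a b \<noteq> 0 \<and> y b c \<noteq> 0. x a b * y b c)"

definition one_plus :: "('l \<Rightarrow> 'l \<Rightarrow> 'r::ring_1) \<Rightarrow> ('l \<Rightarrow> 'l \<Rightarrow> 'r)" where
  "one_plus x = (\<lambda>a b. (if a = b then 1 else 0) + x a b)"

definition McLain :: "('l::linorder \<Rightarrow> 'l \<Rightarrow> 'r::ring_1) monoid" where
  "McLain = \<lparr>carrier = one_plus ` J, monoid.mult = mat_mult, one = one_plus (\<lambda>a b. 0)\<rparr>"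

definition root_subgroup :: "'l \<times> 'l \<Rightarrow> ('l::linorder \<Rightarrow> 'l \<Rightarrow> 'r::ring_1) set" where
  "root_subgroup d = {one_plus (elem_mat r (fst d) (snd d)) | r. True}"

definition closed_roots :: "('l \<times> 'l) set \<Rightarrow> bool" where
  "closed_roots \<Delta> \<longleftrightarrow> (\<forall>a b c. (a, b) \<in> \<Delta> \<longrightarrow> (b, c) \<in> \<Delta> \<longrightarrow> (a, c) \<in> \<Delta>)"

definition M_of :: "('l \<times> 'l) set \<Rightarrow> ('l::linorder \<Rightarrow> 'l \<Rightarrow> 'r::ring_1) set" where
  "M_of \<Delta> = generate McLain (\<Union>d\<in>\<Delta>. root_subgroup d)"

definition derived_roots :: "('l::linorder \<times> 'l) set \<Rightarrow> ('l \<times> 'l) set" where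
  \<comment> \<open>the set \<open>[\<Delta>, \<Delta>]\<close>\<close>
  "derived_roots \<Delta> = {(a, b) \<in> Phi. \<exists>gs. length gs \<ge> 3 \<and> hd gs = a \<and> last gs = b \<and>
     successively (\<lambda>x y. (x, y) \<in> \<Delta>) gs}"


section \<open>Linear characters\<close>

definition add_group :: "'r::ring_1 monoid" where
  "add_group = add_monoid ring_of_type_algebra"

definition mult_group :: "'f::field monoid" where
  "mult_group = mult_of ring_of_type_algebra"

definition right_ideal :: "'r::ring_1 set \<Rightarrow> bool" where
  "right_ideal I \<longleftrightarrow> subgroup I add_group \<and> (\<forall>x\<in>I. \<forall>r. x * r \<in> I)"

definition right_primitive :: "('r::ring_1 \<Rightarrow> 'f::field) \<Rightarrow> bool" where
  "right_primitive \<chi> \<longleftrightarrow> \<chi> \<in> hom add_group mult_group \<and>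
     (\<forall>I. right_ideal I \<longrightarrow> I \<subseteq> kernel add_group mult_group \<chi> \<longrightarrow> I = {0})"


section \<open>Data attached to a basic set\<close>

definition basic :: "('l::linorder \<times> 'l) set \<Rightarrow> bool" where
  "basic D \<longleftrightarrow> finite D \<and> D \<noteq> {} \<and> D \<subseteq> Phi \<and> inj_on fst D \<and> inj_on snd D"

definition row_below :: "'l::linorder \<times> 'l \<Rightarrow> ('l \<times> 'l) set" where
  "row_below d = {(a, c) \<in> Phi. a = fst d \<and> c < snd d}"

definition row_upto :: "'l::linorder \<times> 'l \<Rightarrow> ('l \<times> 'l) set" where
  "row_upto d = {(a, c) \<in> Phi. a = fst d \<and> c \<le> snd d}"

definition Gamma :: "('l::linorder \<times> 'l) set \<Rightarrow> ('l \<times> 'l) set" where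
  "Gamma D = Phi - (\<Union>d\<in>D. row_below d)"

definition Omega :: "('l::linorder \<times> 'l) set \<Rightarrow> ('l \<times> 'l) set" where
  "Omega D = {(a, c) \<in> Phi. \<exists>b d. (a, b) \<in> D \<and> (c, d) \<in> D \<and> a < c \<and> c < b \<and> b < d}"

definition Gamma1 :: "('l::linorder \<times> 'l) set \<Rightarrow> ('l \<times> 'l) set" where
  "Gamma1 D = Gamma D \<union> Omega D"

definition is_lam_hat ::
    "'l \<times> 'l \<Rightarrow> ('r \<Rightarrow> 'f) \<Rightarrow> (('l::linorder \<Rightarrow> 'l \<Rightarrow> 'r::ring_1) \<Rightarrow> 'f::field) \<Rightarrow> bool" where
  "is_lam_hat d \<chi> \<phi> \<longleftrightarrow>
     \<phi> \<in> hom (McLain\<lparr>carrier := M_of (Phi - row_below d)\<rparr>) mult_group \<and>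
     (\<forall>r. \<phi> (one_plus (elem_mat r (fst d) (snd d))) = \<chi> r) \<and>
     (\<forall>e \<in> Phi - row_upto d. \<forall>h \<in> root_subgroup e. \<phi> h = 1)"

text \<open>
  Restricting to \<open>extensional\<close> functions only pins down the irrelevant values outside the
  subgroup; existence and uniqueness are shown in lemma \<open>lam_hat\<close> below.
\<close>

definition lam_hat ::
    "'l \<times> 'l \<Rightarrow> ('r \<Rightarrow> 'f) \<Rightarrow> ('l::linorder \<Rightarrow> 'l \<Rightarrow> 'r::ring_1) \<Rightarrow> 'f::field" where
  "lam_hat d \<chi> = (THE \<phi>. is_lam_hat d \<chi> \<phi> \<and> \<phi> \<in> extensional (M_of (Phi - row_below d)))"

text \<open>
  Only the values of \<open>lam D f\<close> on \<open>H = M_of (Gamma D)\<close> are relevant; \<open>H\<close> lies in the domain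
  \<open>M_of (Phi - row_below d)\<close> of each factor.
\<close>

definition lam ::
    "('l \<times> 'l) set \<Rightarrow> ('l \<times> 'l \<Rightarrow> 'r \<Rightarrow> 'f) \<Rightarrow>
      ('l::linorder \<Rightarrow> 'l \<Rightarrow> 'r::ring_1) \<Rightarrow> 'f::field" where
  "lam D f = (\<lambda>h. \<Prod>d\<in>D. lam_hat d (f d) h)"

definition special_triple :: "('l::linorder \<times> 'l) set \<Rightarrow> bool" where
  "special_triple D \<longleftrightarrow> (\<exists>a1 b1 a2 b2 a3 b3.
     (a1, b1) \<in> D \<and> (a2, b2) \<in> D \<and> (a3, b3) \<in> D \<and>
     a1 < a2 \<and> a2 < a3 \<and> a3 = b1 \<and> b1 < b2 \<and> b2 < b3)"


section \<open>The definitions make sense\<close>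

lemma add_group_simps [simp]:
  "carrier add_group = UNIV" "monoid.mult add_group = (+)" "one add_group = 0"
  by (simp_all add: add_group_def ring_of_type_algebra_def)

lemma mult_group_simps [simp]:
  "carrier mult_group = UNIV - {0}" "monoid.mult mult_group = (*)" "one mult_group = 1"
  by (simp_all add: mult_group_def ring_of_type_algebra_def)

lemma group_add_group: "group add_group"
  by (rule groupI) (auto simp: add.assoc intro: exI[of _ "- x" for x])

lemma group_mult_group: "group mult_group"
proof (rule groupI)
  show "\<exists>y\<in>carrier mult_group. y \<otimes>\<^bsub>mult_group\<^esub> x = \<one>\<^bsub>mult_group\<^esub>"
    if "x \<in> carrier mult_group" for x :: 'a
    using that by (intro bexI[of _ "inverse x"]) auto
qed auto

lemma mat_mult_eq:
  assumes "finite K" "{b. x a b \<noteq> 0 \<and> y b c \<noteq> 0} \<subseteq> K"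
  shows "mat_mult x y a c = (\<Sum>b\<in>K. x a b * y b c)"
  unfolding mat_mult_def by (rule sum.mono_neutral_left) (use assms in auto)

lemma mat_mult_assoc:
  assumes x: "\<And>a. finite {b. x a b \<noteq> 0}" and y: "\<And>a. finite {b. y a b \<noteq> 0}"
  shows "mat_mult (mat_mult x y) z = mat_mult x (mat_mult y z)"
proof (intro ext)
  fix a d
  define B where "B = {b. x a b \<noteq> 0}"
  define C where "C = (\<Union>b\<in>B. {c. y b c \<noteq> 0})"
  have fB: "finite B" and fC: "finite C" using x y by (auto simp: B_def C_def)
  have xy: "mat_mult x y a c = (\<Sum>b\<in>B. x a b * y b c)" for c
    by (rule mat_mult_eq[OF fB]) (auto simp: B_def)
  have yz: "mat_mult y z b d = (\<Sum>c\<in>C. y b c * z c d)" if "b \<in> B" for b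
    by (rule mat_mult_eq[OF fC]) (use that in \<open>auto simp: C_def\<close>)
  have "c \<in> C" if nz: "mat_mult x y a c \<noteq> 0" for c
  proof -
    obtain b where "b \<in> B" "x a b * y b c \<noteq> 0"
      using nz unfolding xy by (rule sum.not_neutral_contains_not_neutral)
    then have "b \<in> B" "y b c \<noteq> 0" by auto
    then show ?thesis unfolding C_def by blast
  qed
  then have "mat_mult (mat_mult x y) z a d = (\<Sum>c\<in>C. mat_mult x y a c * z c d)"
    by (intro mat_mult_eq[OF fC]) auto
  also have "\<dots> = (\<Sum>b\<in>B. x a b * (\<Sum>c\<in>C. y b c * z c d))"
    unfolding xy sum_distrib_left sum_distrib_right
    by (subst sum.swap) (simp add: mult.assoc)
  also have "\<dots> = (\<Sum>b\<in>B. x a b * mat_mult y z b d)"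
    by (simp add: yz)
  also have "\<dots> = mat_mult x (mat_mult y z) a d"
    by (rule mat_mult_eq[OF fB, symmetric]) (auto simp: B_def)
  finally show "mat_mult (mat_mult x y) z a d = mat_mult x (mat_mult y z) a d" .
qed

lemma elem_mat_mult:
  "mat_mult (elem_mat r a b) (elem_mat s c d) = (if b = c then elem_mat (r * s) a d else (\<lambda>_ _. 0))"
proof (intro ext)
  fix i k
  have "mat_mult (elem_mat r a b) (elem_mat s c d) i k
      = (\<Sum>j\<in>{b}. elem_mat r a b i j * elem_mat s c d j k)"
    by (rule mat_mult_eq) (auto simp: elem_mat_def split: if_splits)
  then show "mat_mult (elem_mat r a b) (elem_mat s c d) i k
      = (if b = c then elem_mat (r * s) a d else (\<lambda>_ _. 0)) i k"
    by (auto simp: elem_mat_def)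
qed

lemma elem_mat_in_J: "(a, b) \<in> Phi \<Longrightarrow> elem_mat r a b \<in> J"
  by (auto simp: J_def support_def elem_mat_def Phi_def
      intro: finite_subset[of _ "{(a, b)}"] split: if_splits)

lemma mult_one_plus:
  assumes x: "x \<in> J" and y: "y \<in> J"
  shows "mat_mult (one_plus x) (one_plus y) = one_plus (\<lambda>a b. x a b + y a b + mat_mult x y a b)"
proof (intro ext)
  fix a c
  define K where "K = insert a (insert c (fst ` support x \<union> snd ` support x))"
  have fK: "finite K" using x by (auto simp: K_def J_def)
  have xK: "b \<in> K" if "x a b \<noteq> 0" for b
    using that by (force simp: K_def support_def)
  have aK: "a \<in> K" "c \<in> K" by (auto simp: K_def)
  have "mat_mult (one_plus x) (one_plus y) a c = (\<Sum>b\<in>K. one_plus x a b * one_plus y b c)"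
    by (rule mat_mult_eq[OF fK]) (use xK aK in \<open>auto simp: one_plus_def split: if_splits\<close>)
  also have "\<dots> = (\<Sum>b\<in>K. (if a = b then one_plus y b c else 0) + (if b = c then x a b else 0)
       + x a b * y b c)"
    by (rule sum.cong) (auto simp: one_plus_def algebra_simps)
  also have "\<dots> = one_plus y a c + x a c + (\<Sum>b\<in>K. x a b * y b c)"
    using fK aK by (simp add: sum.distrib)
  also have "(\<Sum>b\<in>K. x a b * y b c) = mat_mult x y a c"
    by (rule mat_mult_eq[OF fK, symmetric]) (use xK in auto)
  finally show "mat_mult (one_plus x) (one_plus y) a c
      = one_plus (\<lambda>a b. x a b + y a b + mat_mult x y a b) a c"
    by (simp add: one_plus_def algebra_simps)
qed

lemma mat_mult_nonzero:
  assumes "mat_mult x y a c \<noteq> 0"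
  obtains b where "x a b \<noteq> 0" "y b c \<noteq> 0"
proof -
  have "{b. x a b \<noteq> 0 \<and> y b c \<noteq> 0} \<noteq> {}"
    using assms unfolding mat_mult_def by (metis (lifting) sum.empty)
  then show ?thesis using that by blast
qed

lemma J_closed:
  assumes x: "x \<in> J" and y: "y \<in> J"
  shows "(\<lambda>a b. x a b + y a b + mat_mult x y a b) \<in> J" (is "?z \<in> J")
proof -
  have xP: "u < v" if "x u v \<noteq> 0" for u v using x that by (auto simp: J_def support_def Phi_def)
  have yP: "u < v" if "y u v \<noteq> 0" for u v using y that by (auto simp: J_def support_def Phi_def)
  have "(a, b) \<in> (support x \<union> support y \<union> fst ` support x \<times> snd ` support y) \<inter> Phi"
    if "?z a b \<noteq> 0" for a b
  proof -
    consider "x a b \<noteq> 0" | "y a b \<noteq> 0" | "mat_mult x y a b \<noteq> 0"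
      using \<open>?z a b \<noteq> 0\<close> by fastforce
    then show ?thesis
    proof cases
      case 1
      then show ?thesis using xP[OF 1] by (simp add: support_def Phi_def)
    next
      case 2
      then show ?thesis using yP[OF 2] by (simp add: support_def Phi_def)
    next
      case 3
      then obtain c where c: "x a c \<noteq> 0" "y c b \<noteq> 0" by (rule mat_mult_nonzero)
      have "a < b" using xP[OF c(1)] yP[OF c(2)] by order
      moreover have "a \<in> fst ` support x" "b \<in> snd ` support y"
        using c by (force simp: support_def)+
      ultimately show ?thesis by (simp add: Phi_def)
    qed
  qed
  then have sub: "support ?z \<subseteq> (support x \<union> support y \<union> fst ` support x \<times> snd ` support y) \<inter> Phi"
    unfolding support_def[of ?z] by blast
  moreover have "finite (support x \<union> support y \<union> fst ` support x \<times> snd ` support y)"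
    using x y by (simp add: J_def)
  ultimately show ?thesis
    unfolding J_def by (auto intro: finite_subset)
qed

lemma zero_in_J: "(\<lambda>a b. 0) \<in> J"
  by (simp add: J_def support_def)

lemma one_plus_finite_row:
  assumes "x \<in> J" shows "finite {b. one_plus x a b \<noteq> 0}"
proof (rule finite_subset)
  show "{b. one_plus x a b \<noteq> 0} \<subseteq> insert a (snd ` support x)"
    by (force simp: one_plus_def support_def split: if_splits)
qed (use assms in \<open>auto simp: J_def\<close>)

lemma one_plus_zero_mult:
  assumes "y \<in> J" shows "mat_mult (one_plus (\<lambda>a b. 0)) (one_plus y) = one_plus y"
  by (subst mult_one_plus[OF zero_in_J assms]) (simp add: mat_mult_def)

lemma left_inverse:
  assumes "x \<in> J"
  shows "\<exists>y\<in>J. mat_mult (one_plus y) (one_plus x) = one_plus (\<lambda>a b. 0)"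
  using assms
proof (induction "card (support x)" arbitrary: x rule: less_induct)
  case less
  show ?case
  proof (cases "support x = {}")
    case True
    then have "x = (\<lambda>a b. 0)" by (auto simp: support_def)
    then show ?thesis using one_plus_zero_mult[OF zero_in_J] zero_in_J by blast
  next
    case False
    have fin: "finite (support x)" and sub: "support x \<subseteq> Phi"
      using less.prems by (auto simp: J_def)
    define a where "a = Max (fst ` support x)"
    have "a \<in> fst ` support x" unfolding a_def using False fin by (intro Max_in) auto
    then obtain b where b: "(a, b) \<in> support x" by auto
    then have ab: "(a, b) \<in> Phi" using sub by auto
    have zero: "x b c = 0" for c
    proof (rule ccontr)
      assume "x b c \<noteq> 0"
      then have "b \<in> fst ` support x" by (force simp: support_def)
      then have "b \<le> a" unfolding a_def using fin by auto
      then show False using ab by (auto simp: Phi_def)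
    qed
    define e where "e = elem_mat (- x a b) a b"
    have eJ: "e \<in> J" unfolding e_def by (rule elem_mat_in_J[OF ab])
    define z where "z = (\<lambda>c d. e c d + x c d + mat_mult e x c d)"
    have "mat_mult e x c d = 0" for c d
      using zero by (auto simp: mat_mult_def e_def elem_mat_def intro!: sum.neutral)
    then have z: "z c d = (if c = a \<and> d = b then 0 else x c d)" for c d
      by (auto simp: z_def e_def elem_mat_def)
    have zJ: "z \<in> J" unfolding z_def by (rule J_closed[OF eJ less.prems])
    have "support z = support x - {(a, b)}" by (auto simp: support_def z)
    then have "support z \<subset> support x" using b by blast
    then have "card (support z) < card (support x)" using fin by (rule psubset_card_mono[rotated])
    from less.hyps[OF this zJ] obtain y where y: "y \<in> J"
      "mat_mult (one_plus y) (one_plus z) = one_plus (\<lambda>a b. 0)" by auto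
    have "one_plus z = mat_mult (one_plus e) (one_plus x)"
      unfolding z_def by (rule mult_one_plus[OF eJ less.prems, symmetric])
    with y(2) have "mat_mult (mat_mult (one_plus y) (one_plus e)) (one_plus x) = one_plus (\<lambda>a b. 0)"
      by (simp add: mat_mult_assoc one_plus_finite_row y(1) eJ)
    then show ?thesis
      unfolding mult_one_plus[OF y(1) eJ] using J_closed[OF y(1) eJ] by blast
  qed
qed

lemma McLain_simps [simp]:
  "carrier McLain = one_plus ` J" "monoid.mult McLain = mat_mult"
  "one McLain = one_plus (\<lambda>a b. 0)"
  by (simp_all add: McLain_def)

theorem group_McLain: "group (McLain :: ('l::linorder \<Rightarrow> 'l \<Rightarrow> 'r::ring_1) monoid)"
proof (rule groupI)
  show "x \<otimes>\<^bsub>McLain\<^esub> y \<in> carrier McLain" if "x \<in> carrier McLain" "y \<in> carrier McLain"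
    for x y :: "'l \<Rightarrow> 'l \<Rightarrow> 'r"
    using that J_closed by (auto simp: mult_one_plus intro!: imageI)
  show "\<exists>y\<in>carrier McLain. y \<otimes>\<^bsub>McLain\<^esub> x = \<one>\<^bsub>McLain\<^esub>" if "x \<in> carrier McLain"
    for x :: "'l \<Rightarrow> 'l \<Rightarrow> 'r"
    using that left_inverse by auto
qed (auto simp: zero_in_J one_plus_zero_mult mat_mult_assoc one_plus_finite_row)

lemma roots_in_McLain: "\<Delta> \<subseteq> Phi \<Longrightarrow> (\<Union>d\<in>\<Delta>. root_subgroup d) \<subseteq> carrier McLain"
  by (auto simp: root_subgroup_def intro!: imageI elem_mat_in_J)

lemma subgroup_M_of: "\<Delta> \<subseteq> Phi \<Longrightarrow> subgroup (M_of \<Delta>) McLain"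
  unfolding M_of_def by (rule group.generate_is_subgroup[OF group_McLain roots_in_McLain])

lemma M_of_mono: "\<Delta> \<subseteq> \<Delta>' \<Longrightarrow> M_of \<Delta> \<subseteq> M_of \<Delta>'"
  unfolding M_of_def by (rule group.mono_generate[OF group_McLain]) auto

lemma closed_Gamma: "closed_roots (Gamma D)"
  by (force simp: closed_roots_def Gamma_def row_below_def Phi_def)

lemma closed_Hi: "closed_roots (Phi - row_below d)"
  by (force simp: closed_roots_def row_below_def Phi_def)

lemma closed_Gamma1:
  assumes "basic D" shows "closed_roots (Gamma1 D)"
proof (unfold closed_roots_def, intro allI impI)
  fix x y z assume xy: "(x, y) \<in> Gamma1 D" and yz: "(y, z) \<in> Gamma1 D"
  have lt: "x < y" "y < z" using xy yz by (auto simp: Gamma1_def Gamma_def Omega_def Phi_def)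
  have inj: "b = b'" if "(a, b) \<in> D" "(a, b') \<in> D" for a b b'
    using assms that by (force simp: basic_def inj_on_def)
  have G: "(a, c) \<in> Gamma1 D \<longleftrightarrow>
      a < c \<and> (\<forall>b. (a, b) \<in> D \<longrightarrow> c < b \<longrightarrow> (\<exists>d. (c, d) \<in> D \<and> b < d))" for a c
  proof -
    have "(a, c) \<in> Gamma D \<longleftrightarrow> a < c \<and> (\<forall>b. (a, b) \<in> D \<longrightarrow> \<not> c < b)"
      by (force simp: Gamma_def row_below_def Phi_def)
    moreover have "(a, c) \<in> Omega D \<longleftrightarrow>
        a < c \<and> (\<exists>b. (a, b) \<in> D \<and> c < b \<and> (\<exists>d. (c, d) \<in> D \<and> b < d))"
      unfolding Omega_def Phi_def by blast
    ultimately show ?thesis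
      unfolding Gamma1_def Un_iff using inj[of a] by blast
  qed
  show "(x, z) \<in> Gamma1 D"
    unfolding G
  proof (intro conjI allI impI)
    show "x < z" using lt by order
    fix b assume b: "(x, b) \<in> D" "z < b"
    then obtain d where d: "(y, d) \<in> D" "b < d" using xy lt unfolding G by (meson less_trans)
    then obtain d' where "(z, d') \<in> D" "d < d'" using yz b unfolding G by (meson less_trans)
    then show "\<exists>d. (z, d) \<in> D \<and> b < d" using d by (meson less_trans)
  qed
qed

lemma H_subset_Hi: "d \<in> D \<Longrightarrow> M_of (Gamma D) \<subseteq> M_of (Phi - row_below d)"
  by (rule M_of_mono) (auto simp: Gamma_def)

lemma H_subset_I: "M_of (Gamma D) \<subseteq> M_of (Gamma1 D)"
  by (rule M_of_mono) (auto simp: Gamma1_def)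

definition row_zero :: "'l \<times> 'l \<Rightarrow> ('l::linorder \<Rightarrow> 'l \<Rightarrow> 'r::ring_1) set" where
  "row_zero d = {one_plus x | x. x \<in> J \<and> (\<forall>c. c < snd d \<longrightarrow> x (fst d) c = 0)}"

lemma row_zero_mult:
  assumes p: "p \<in> row_zero d" and q: "q \<in> row_zero d" and d: "d \<in> Phi"
  shows "mat_mult p q \<in> row_zero d"
    and "mat_mult p q (fst d) (snd d) = p (fst d) (snd d) + q (fst d) (snd d)"
proof -
  obtain x where x: "p = one_plus x" "x \<in> J" "\<And>c. c < snd d \<Longrightarrow> x (fst d) c = 0"
    using p unfolding row_zero_def by blast
  obtain y where y: "q = one_plus y" "y \<in> J" "\<And>c. c < snd d \<Longrightarrow> y (fst d) c = 0"
    using q unfolding row_zero_def by blast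
  have zero: "mat_mult x y (fst d) c = 0" if "c \<le> snd d" for c
  proof (rule ccontr)
    assume "mat_mult x y (fst d) c \<noteq> 0"
    then obtain b where b: "x (fst d) b \<noteq> 0" "y b c \<noteq> 0" by (rule mat_mult_nonzero)
    have "b < c" using b(2) y(2) by (auto simp: J_def support_def Phi_def)
    then have "b < snd d" using that by order
    then show False using x(3) b(1) by simp
  qed
  let ?z = "\<lambda>a b. x a b + y a b + mat_mult x y a b"
  have z: "mat_mult p q = one_plus ?z"
    unfolding x(1) y(1) by (rule mult_one_plus[OF x(2) y(2)])
  have "?z (fst d) c = 0" if "c < snd d" for c
    using that x(3) y(3) zero[of c] by simp
  then show "mat_mult p q \<in> row_zero d"
    unfolding row_zero_def z using J_closed[OF x(2) y(2)] by blast
  have "fst d \<noteq> snd d" using d by (auto simp: Phi_def)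
  then show "mat_mult p q (fst d) (snd d) = p (fst d) (snd d) + q (fst d) (snd d)"
    unfolding z using zero[of "snd d"] by (simp add: one_plus_def x(1) y(1))
qed

lemma root_subgroup_row_zero:
  assumes "e \<in> Phi - row_below d" shows "root_subgroup e \<subseteq> row_zero d"
proof
  fix h assume "h \<in> root_subgroup e"
  then obtain r where h: "h = one_plus (elem_mat r (fst e) (snd e))"
    by (auto simp: root_subgroup_def)
  have "elem_mat r (fst e) (snd e) \<in> J" by (rule elem_mat_in_J) (use assms in auto)
  moreover have "elem_mat r (fst e) (snd e) (fst d) c = 0" if "c < snd d" for c
    using assms that by (cases e) (auto simp: elem_mat_def row_below_def)
  ultimately show "h \<in> row_zero d" unfolding h row_zero_def by blast
qed

lemma inv_root:
  assumes "h \<in> root_subgroup e" "e \<in> Phi"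
  shows "inv\<^bsub>McLain\<^esub> h \<in> root_subgroup e"
proof -
  obtain r where h: "h = one_plus (elem_mat r (fst e) (snd e))"
    using assms(1) by (auto simp: root_subgroup_def)
  have J: "elem_mat s (fst e) (snd e) \<in> J" for s by (rule elem_mat_in_J) (use assms in auto)
  have ne: "snd e \<noteq> fst e" using assms(2) by (auto simp: Phi_def)
  let ?g = "one_plus (elem_mat (- r) (fst e) (snd e))"
  have "mat_mult ?g h = one_plus (\<lambda>a b. 0)"
    unfolding h mult_one_plus[OF J J] elem_mat_mult using ne
    by (simp add: elem_mat_def one_plus_def fun_eq_iff)
  then have "inv\<^bsub>McLain\<^esub> h = ?g"
    using J by (intro group.inv_equality[OF group_McLain]) (auto simp: h)
  then show ?thesis by (auto simp: root_subgroup_def)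
qed

lemma M_of_induct [consumes 2, case_names one root mult]:
  assumes "h \<in> M_of \<Delta>" "\<Delta> \<subseteq> Phi"
    and one: "P (one_plus (\<lambda>a b. 0))"
    and root: "\<And>e h. e \<in> \<Delta> \<Longrightarrow> h \<in> root_subgroup e \<Longrightarrow> P h"
    and mult: "\<And>g h. g \<in> M_of \<Delta> \<Longrightarrow> h \<in> M_of \<Delta> \<Longrightarrow> P g \<Longrightarrow> P h \<Longrightarrow> P (mat_mult g h)"
  shows "P h"
  using assms(1) unfolding M_of_def
proof (induction rule: generate.induct)
  case one
  then show ?case using assms(3) by simp
next
  case (incl h)
  then show ?case using root by blast
next
  case (inv h)
  then show ?case using root inv_root assms(2) by blast
next
  case (eng h1 h2)
  then show ?case using mult unfolding M_of_def by simp
qed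

lemma one_row_zero: "one_plus (\<lambda>a b. 0) \<in> row_zero d"
  unfolding row_zero_def using zero_in_J by blast

lemma Hi_row_zero:
  assumes "h \<in> M_of (Phi - row_below d)" "d \<in> Phi" shows "h \<in> row_zero d"
  using assms(1) Diff_subset
proof (induction rule: M_of_induct)
  case one
  show ?case by (rule one_row_zero)
next
  case (root e h)
  then show ?case using root_subgroup_row_zero by blast
next
  case (mult g h)
  then show ?case using row_zero_mult(1) assms(2) by blast
qed

lemma root_in_M_of: "e \<in> \<Delta> \<Longrightarrow> root_subgroup e \<subseteq> M_of \<Delta>"
  unfolding M_of_def by (blast intro: generate.incl)

lemma is_lam_hat_exists:
  fixes \<chi> :: "'r::ring_1 \<Rightarrow> 'f::field" and d :: "'l::linorder \<times> 'l"
  assumes d: "d \<in> Phi" and \<chi>: "\<chi> \<in> hom add_group mult_group"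
  shows "is_lam_hat d \<chi> (\<lambda>h. \<chi> (h (fst d) (snd d)))"
proof -
  let ?\<phi> = "\<lambda>h::'l \<Rightarrow> 'l \<Rightarrow> 'r. \<chi> (h (fst d) (snd d))"
  have nz: "\<chi> r \<noteq> 0" for r using hom_in_carrier[OF \<chi>, of r] by simp
  have add: "\<chi> (r + s) = \<chi> r * \<chi> s" for r s using hom_mult[OF \<chi>, of r s] by simp
  have zero: "\<chi> 0 = 1" using hom_one[OF \<chi> group_add_group group_mult_group] by simp
  have ne: "fst d \<noteq> snd d" using d by (auto simp: Phi_def)
  have "?\<phi> \<in> hom (McLain\<lparr>carrier := M_of (Phi - row_below d)\<rparr>) mult_group"
  proof (rule homI)
    fix g h :: "'l \<Rightarrow> 'l \<Rightarrow> 'r"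
    assume "g \<in> carrier (McLain\<lparr>carrier := M_of (Phi - row_below d)\<rparr>)"
      and "h \<in> carrier (McLain\<lparr>carrier := M_of (Phi - row_below d)\<rparr>)"
    then have "g \<in> row_zero d" "h \<in> row_zero d" using Hi_row_zero[OF _ d] by auto
    from row_zero_mult(2)[OF this d]
    show "?\<phi> (g \<otimes>\<^bsub>McLain\<lparr>carrier := M_of (Phi - row_below d)\<rparr>\<^esub> h) = ?\<phi> g \<otimes>\<^bsub>mult_group\<^esub> ?\<phi> h"
      by (simp add: add)
  qed (simp add: nz)
  moreover have "\<forall>r. ?\<phi> (one_plus (elem_mat r (fst d) (snd d))) = \<chi> r"
    using ne by (simp add: one_plus_def elem_mat_def)
  moreover have "?\<phi> h = 1" if e: "e \<in> Phi - row_upto d" "h \<in> root_subgroup e" for e h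
  proof -
    obtain r where h: "h = one_plus (elem_mat r (fst e) (snd e))"
      using e(2) by (auto simp: root_subgroup_def)
    have "e \<noteq> d" using e(1) d by (auto simp: row_upto_def)
    then have "h (fst d) (snd d) = 0"
      using ne by (auto simp: h one_plus_def elem_mat_def prod_eq_iff)
    then show ?thesis by (simp add: zero)
  qed
  ultimately show ?thesis unfolding is_lam_hat_def by blast
qed

lemma is_lam_hat_unique:
  assumes d: "d \<in> Phi"
    and 1: "is_lam_hat d \<chi> \<phi>" and 2: "is_lam_hat d \<chi> \<psi>"
    and h: "h \<in> M_of (Phi - row_below d)"
  shows "\<phi> h = \<psi> h"
proof -
  let ?G = "McLain\<lparr>carrier := M_of (Phi - row_below d)\<rparr>"
  have G: "group ?G"
    by (rule subgroup.subgroup_is_group[OF subgroup_M_of group_McLain]) auto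
  have hom: "\<phi> \<in> hom ?G mult_group" "\<psi> \<in> hom ?G mult_group"
    using 1 2 by (auto simp: is_lam_hat_def)
  show ?thesis
    using h Diff_subset
  proof (induction rule: M_of_induct)
    case one
    show ?case using hom_one[OF hom(1) G group_mult_group] hom_one[OF hom(2) G group_mult_group]
      by simp
  next
    case (root e h)
    show ?case
    proof (cases "e = d")
      case True
      then show ?thesis using root(2) 1 2 unfolding is_lam_hat_def root_subgroup_def by auto
    next
      case False
      then have "e \<in> Phi - row_upto d"
        using root(1) by (cases e; cases d) (auto simp: row_upto_def row_below_def)
      then show ?thesis using root(2) 1 2 unfolding is_lam_hat_def by simp
    qed
  next
    case (mult g h)
    then show ?case using hom_mult[OF hom(1), of g h] hom_mult[OF hom(2), of g h] by simp
  qed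
qed

lemma lam_hat:
  fixes \<chi> :: "'r::ring_1 \<Rightarrow> 'f::field" and d :: "'l::linorder \<times> 'l"
  assumes d: "d \<in> Phi" and \<chi>: "\<chi> \<in> hom add_group mult_group"
  shows "\<exists>!\<phi>. is_lam_hat d \<chi> \<phi> \<and> \<phi> \<in> extensional (M_of (Phi - row_below d))"
    and "is_lam_hat d \<chi> (lam_hat d \<chi>)"
proof -
  let ?H = "M_of (Phi - row_below d) :: ('l \<Rightarrow> 'l \<Rightarrow> 'r) set"
  let ?\<phi> = "restrict (\<lambda>h. \<chi> (h (fst d) (snd d))) ?H"
  have sub: "subgroup ?H McLain" by (rule subgroup_M_of) auto
  have root: "h \<in> ?H" if "e \<in> insert d (Phi - row_upto d)" "h \<in> root_subgroup e" for e h
  proof -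
    have "e \<in> Phi - row_below d" using that(1) d by (auto simp: row_upto_def row_below_def)
    then show ?thesis using root_in_M_of that(2) by blast
  qed
  have rd: "one_plus (elem_mat r (fst d) (snd d)) \<in> root_subgroup d" for r :: 'r
    by (auto simp: root_subgroup_def)
  have "is_lam_hat d \<chi> ?\<phi>"
    unfolding is_lam_hat_def
  proof (intro conjI allI ballI)
    show "?\<phi> \<in> hom (McLain\<lparr>carrier := ?H\<rparr>) mult_group"
      using is_lam_hat_exists[OF d \<chi>] subgroup.m_closed[OF sub]
      unfolding is_lam_hat_def hom_def by (simp add: Pi_iff)
    show "?\<phi> (one_plus (elem_mat r (fst d) (snd d))) = \<chi> r" for r
      using is_lam_hat_exists[OF d \<chi>] root[OF insertI1 rd] unfolding is_lam_hat_def by simp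
    show "?\<phi> h = 1" if "e \<in> Phi - row_upto d" "h \<in> root_subgroup e" for e h
      using is_lam_hat_exists[OF d \<chi>] root[of e h] that unfolding is_lam_hat_def by simp
  qed
  then show *: "\<exists>!\<phi>. is_lam_hat d \<chi> \<phi> \<and> \<phi> \<in> extensional ?H"
    using is_lam_hat_unique[OF d] by (intro ex1I[of _ ?\<phi>]) (auto intro!: extensionalityI[of _ ?H])
  show "is_lam_hat d \<chi> (lam_hat d \<chi>)"
    unfolding lam_hat_def using theI'[OF *] by blast
qed

end

theory Submission
  imports Defs
begin

text \<open>
  An entry \<open>(a, b)\<close> is additive on \<open>M(\<Delta>)\<close> as soon as \<open>\<Delta>\<close> contains no two-step chain
  \<open>(a, c), (c, b)\<close>, and by closedness two-step chains are the only ones that matter.  So if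
  \<open>[\<Gamma>\<^sub>1, \<Gamma>\<^sub>1]\<close> misses \<open>D\<close>, the formula for \<open>\<lambda>\<close> in terms of the entries at \<open>D\<close> still defines a
  homomorphism on \<open>I\<close>.  Conversely, a chain \<open>(a, c), (c, b)\<close> in \<open>\<Gamma>\<^sub>1\<close> with \<open>(a, b) \<in> D\<close> makes
  every element of \<open>M\<^bsub>ab\<^esub>\<close> a commutator in \<open>I\<close>, whereas \<open>\<lambda>\<close> restricts to \<open>f (a, b)\<close> on
  \<open>M\<^bsub>ab\<^esub>\<close>, which is nontrivial.
\<close>

section \<open>Chains of roots and special triples\<close>

lemma derived_roots_closed:
  assumes "\<Delta> \<subseteq> Phi" "closed_roots \<Delta>"
  shows "(a, b) \<in> derived_roots \<Delta> \<longleftrightarrow> (\<exists>c. (a, c) \<in> \<Delta> \<and> (c, b) \<in> \<Delta>)"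
proof
  \<comment> \<open>Closedness contracts a whole chain to a single root from its first to its last
    point.\<close>
  have path: "(g, last gs) \<in> \<Delta>"
    if "gs \<noteq> []" "successively (\<lambda>x y. (x, y) \<in> \<Delta>) (g # gs)" for g gs
    using that
  proof (induction gs arbitrary: g)
    case (Cons h hs)
    then show ?case using assms(2) by (cases hs) (auto simp: closed_roots_def)
  qed simp
  assume "(a, b) \<in> derived_roots \<Delta>"
  then obtain gs where gs: "length gs \<ge> 3" "hd gs = a" "last gs = b"
    "successively (\<lambda>x y. (x, y) \<in> \<Delta>) gs"
    by (auto simp: derived_roots_def)
  \<comment> \<open>Length at least 3 leaves a nonempty tail after \<open>c\<close>, which
    \<open>path\<close> contracts to \<open>(c, b)\<close>.\<close>
  then obtain c e es where "gs = a # c # e # es"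
    by (cases gs; cases "tl gs"; cases "tl (tl gs)") auto
  with gs path[of "e # es" c] show "\<exists>c. (a, c) \<in> \<Delta> \<and> (c, b) \<in> \<Delta>"
    by auto
next
  assume "\<exists>c. (a, c) \<in> \<Delta> \<and> (c, b) \<in> \<Delta>"
  then obtain c where c: "(a, c) \<in> \<Delta>" "(c, b) \<in> \<Delta>" by blast
  then have "(a, b) \<in> Phi" using assms by (auto simp: closed_roots_def)
  with c show "(a, b) \<in> derived_roots \<Delta>"
    by (auto simp: derived_roots_def intro!: exI[of _ "[a, c, b]"])
qed

lemma derived_roots_mono: "\<Delta> \<subseteq> \<Delta>' \<Longrightarrow> derived_roots \<Delta> \<subseteq> derived_roots \<Delta>'"
  using successively_mono[of "\<lambda>x y. (x, y) \<in> \<Delta>" _ "\<lambda>x y. (x, y) \<in> \<Delta>'"]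
  unfolding derived_roots_def by blast

lemma Gamma1_subset_Phi: "Gamma1 D \<subseteq> Phi"
  by (auto simp: Gamma1_def Gamma_def Omega_def)

text \<open>A root strictly left of \<open>(a, b)\<close> in row \<open>a\<close> was removed from
  \<Gamma>, so it comes from \<Omega>. Since \<open>D\<close> has only one element in row
  \<open>a\<close>, the bound provided by \<Omega> refers to this \<open>b\<close>.\<close>

lemma Gamma1_below:
  assumes "(a, c) \<in> Gamma1 D" "(a, b) \<in> D" "c < b" "basic D"
  obtains d where "(c, d) \<in> D" "b < d"
proof -
  have uniq: "b' = b" if "(a, b') \<in> D" for b'
    using inj_onD[of fst D "(a, b')" "(a, b)"] assms(2,4) that by (simp add: basic_def)
  have "(a, c) \<in> Phi" using assms(1) Gamma1_subset_Phi by blast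
  then have "(a, c) \<in> row_below (a, b)" using assms(3) by (simp add: row_below_def)
  then have "(a, c) \<in> Omega D" using assms(1,2) unfolding Gamma1_def Gamma_def by blast
  then show ?thesis using uniq that unfolding Omega_def by blast
qed

text \<open>Consecutive members of the triple each yield a root of \<Omega>, and these two roots
  form a chain joining the ends of the first member.\<close>

lemma special_triple_imp_derived_Omega:
  assumes "special_triple D"
  shows "derived_roots (Omega D) \<inter> D \<noteq> {}"
proof -
  obtain a b c d e where D: "(a, b) \<in> D" "(c, d) \<in> D" "(b, e) \<in> D"
    and lt: "a < c" "c < b" "b < d" "d < e"
    using assms unfolding special_triple_def by blast
  have "(a, c) \<in> Omega D" "(c, b) \<in> Omega D"
    using D lt unfolding Omega_def Phi_def by blast+
  moreover have "(a, b) \<in> Phi" using lt by (simp add: Phi_def)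
  ultimately have "(a, b) \<in> derived_roots (Omega D)"
    by (auto simp: derived_roots_def intro!: exI[of _ "[a, c, b]"])
  with D show ?thesis by blast
qed

text \<open>\<open>Gamma1_below\<close> applies twice along the chain \<open>(a, c)\<close>,
  \<open>(c, b)\<close>: the first step produces a member of \<open>D\<close> in row
  \<open>c\<close> ending beyond \<open>b\<close>, which then serves as the reference for the second
  step.\<close>

lemma derived_Gamma1_imp_special_triple:
  assumes "basic D" "derived_roots (Gamma1 D) \<inter> D \<noteq> {}"
  shows "special_triple D"
proof -
  obtain a b where ab: "(a, b) \<in> derived_roots (Gamma1 D)" "(a, b) \<in> D"
    using assms(2) by auto
  then obtain c where c: "(a, c) \<in> Gamma1 D" "(c, b) \<in> Gamma1 D"
    using derived_roots_closed[OF Gamma1_subset_Phi closed_Gamma1[OF assms(1)]] by blast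
  have lt: "a < c" "c < b" using c Gamma1_subset_Phi by (auto simp: Phi_def)
  obtain d where d: "(c, d) \<in> D" "b < d"
    using Gamma1_below[OF c(1) ab(2) lt(2) assms(1)] .
  obtain e where "(b, e) \<in> D" "d < e"
    using Gamma1_below[OF c(2) d assms(1)] .
  with ab d lt show ?thesis unfolding special_triple_def by blast
qed

section \<open>Entries on M(\<Delta>) and the extension of \<lambda>\<close>

text \<open>Turns membership in a generated subgroup into a condition on entries. Closedness absorbs
  the product term \<open>mat_mult x y\<close>, whose nonzero entries sit at ends of two-step
  chains.\<close>

lemma M_of_closed_support:
  assumes "h \<in> M_of \<Delta>" "\<Delta> \<subseteq> Phi" "closed_roots \<Delta>"
  obtains x where "h = one_plus x" "x \<in> J" "support x \<subseteq> \<Delta>"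
proof -
  have "\<exists>x. h = one_plus x \<and> x \<in> J \<and> support x \<subseteq> \<Delta>"
    using assms(1,2)
  proof (induction rule: M_of_induct)
    case one
    show ?case using zero_in_J by (intro exI[of _ "\<lambda>a b. 0"]) (simp add: support_def)
  next
    case (root e h)
    then obtain r where h: "h = one_plus (elem_mat r (fst e) (snd e))"
      by (auto simp: root_subgroup_def)
    have "(fst e, snd e) \<in> Phi" using root(1) assms(2) by auto
    then have "elem_mat r (fst e) (snd e) \<in> J" by (rule elem_mat_in_J)
    moreover have "support (elem_mat r (fst e) (snd e)) \<subseteq> \<Delta>"
      using root(1) by (auto simp: support_def elem_mat_def split: if_splits)
    ultimately show ?case using h by blast
  next
    case (mult g h)
    then obtain x y where x: "g = one_plus x" "x \<in> J" "support x \<subseteq> \<Delta>"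
      and y: "h = one_plus y" "y \<in> J" "support y \<subseteq> \<Delta>" by blast
    let ?z = "\<lambda>a b. x a b + y a b + mat_mult x y a b"
    have "(a, b) \<in> \<Delta>" if nz: "?z a b \<noteq> 0" for a b
    proof -
      consider "x a b \<noteq> 0" | "y a b \<noteq> 0" | "mat_mult x y a b \<noteq> 0"
        using nz by fastforce
      then show ?thesis
      proof cases
        case 3
        then obtain c where "x a c \<noteq> 0" "y c b \<noteq> 0" by (rule mat_mult_nonzero)
        then show ?thesis
          using x(3) y(3) assms(3) unfolding closed_roots_def support_def by blast
      qed (use x(3) y(3) in \<open>auto simp: support_def\<close>)
    qed
    then have "support ?z \<subseteq> \<Delta>" by (auto simp: support_def)
    then show ?case
      using mult_one_plus[OF x(2) y(2)] J_closed[OF x(2) y(2)] x(1) y(1) by blast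
  qed
  then show ?thesis using that by blast
qed

lemma mult_entry_additive:
  assumes g: "g \<in> M_of \<Delta>" and h: "h \<in> M_of \<Delta>" and \<Delta>: "\<Delta> \<subseteq> Phi" "closed_roots \<Delta>"
    and ab: "a \<noteq> b" "(a, b) \<notin> derived_roots \<Delta>"
  shows "mat_mult g h a b = g a b + h a b"
proof -
  obtain x where x: "g = one_plus x" "x \<in> J" "support x \<subseteq> \<Delta>"
    using M_of_closed_support[OF g \<Delta>] .
  obtain y where y: "h = one_plus y" "y \<in> J" "support y \<subseteq> \<Delta>"
    using M_of_closed_support[OF h \<Delta>] .
  have "mat_mult x y a b = 0"
  proof (rule ccontr)
    assume "mat_mult x y a b \<noteq> 0"
    then obtain c where "x a c \<noteq> 0" "y c b \<noteq> 0" by (rule mat_mult_nonzero)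
    then have "(a, c) \<in> \<Delta>" "(c, b) \<in> \<Delta>" using x(3) y(3) by (auto simp: support_def)
    then show False using ab(2) derived_roots_closed[OF \<Delta>] by blast
  qed
  \<comment> \<open>Off the diagonal the identity matrix contributes nothing; on it, the sum of the
    entries would count it twice.\<close>
  then show ?thesis
    using ab(1) mult_one_plus[OF x(2) y(2)] by (simp add: x(1) y(1) one_plus_def)
qed

text \<open>Each evaluation map satisfies \<open>is_lam_hat\<close>, so uniqueness identifies it
  with \<open>lam_hat\<close> on its domain. The resulting formula makes sense for every matrix, not
  only on H.\<close>

lemma lam_eq:
  assumes "D \<subseteq> Phi" "\<forall>d\<in>D. f d \<in> hom add_group mult_group" "h \<in> M_of (Gamma D)"
  shows "lam D f h = (\<Prod>d\<in>D. f d (h (fst d) (snd d)))"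
  unfolding lam_def
proof (rule prod.cong[OF refl])
  fix d assume d: "d \<in> D"
  then have Phi: "d \<in> Phi" and \<chi>: "f d \<in> hom add_group mult_group" using assms by auto
  have "h \<in> M_of (Phi - row_below d)" using H_subset_Hi[OF d] assms(3) by blast
  then show "lam_hat d (f d) h = f d (h (fst d) (snd d))"
    using is_lam_hat_unique[OF Phi lam_hat(2)[OF Phi \<chi>] is_lam_hat_exists[OF Phi \<chi>]] by blast
qed

lemma char_simps:
  assumes "\<chi> \<in> hom add_group mult_group"
  shows "\<chi> r \<noteq> 0" "\<chi> (r + s) = \<chi> r * \<chi> s" "\<chi> 0 = 1"
  using hom_in_carrier[OF assms, of r] hom_mult[OF assms, of r s]
    hom_one[OF assms group_add_group group_mult_group] by simp_all

lemma extension_if_derived_disjoint: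
  fixes f :: "'l::linorder \<times> 'l \<Rightarrow> 'r::ring_1 \<Rightarrow> 'f::field"
  assumes D: "basic D" and f: "\<forall>d\<in>D. f d \<in> hom add_group mult_group"
    and disj: "derived_roots (Gamma1 D) \<inter> D = {}"
  shows "\<exists>\<mu> \<in> hom (McLain\<lparr>carrier := M_of (Gamma1 D)\<rparr>) mult_group.
    \<forall>h \<in> M_of (Gamma D). \<mu> h = lam D f h"
\<comment> \<open>The witness is the formula of \<open>lam_eq\<close>, now read on all of I.\<close>
proof (rule bexI[of _ "\<lambda>h. \<Prod>d\<in>D. f d (h (fst d) (snd d))"])
  have Phi: "D \<subseteq> Phi" and fin: "finite D" using D by (auto simp: basic_def)
  show "\<forall>h \<in> M_of (Gamma D). (\<Prod>d\<in>D. f d (h (fst d) (snd d))) = lam D f h"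
    using lam_eq[OF Phi f] by simp
  have add: "mat_mult g h (fst d) (snd d) = g (fst d) (snd d) + h (fst d) (snd d)"
    if "d \<in> D" "g \<in> M_of (Gamma1 D)" "h \<in> M_of (Gamma1 D)"
    for d and g h :: "'l \<Rightarrow> 'l \<Rightarrow> 'r"
    by (rule mult_entry_additive[OF that(2,3) Gamma1_subset_Phi closed_Gamma1[OF D]])
      (use that Phi disj in \<open>auto simp: Phi_def\<close>)
  show "(\<lambda>h. \<Prod>d\<in>D. f d (h (fst d) (snd d)))
      \<in> hom (McLain\<lparr>carrier := M_of (Gamma1 D)\<rparr>) mult_group"
    by (rule homI)
      (use fin f in \<open>simp_all add: add char_simps prod.distrib[symmetric]\<close>)
qed

section \<open>Commutators as the obstruction to extending \<lambda>\<close>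

text \<open>The commutator relation, written as xy = z(yx) to avoid inverses.\<close>

lemma commutator_identity:
  fixes r :: "'r::ring_1" and a b c :: "'l::linorder"
  assumes "a < c" "c < b"
  shows "mat_mult (one_plus (elem_mat r a c)) (one_plus (elem_mat s c b))
    = mat_mult (one_plus (elem_mat (r * s) a b))
        (mat_mult (one_plus (elem_mat s c b)) (one_plus (elem_mat r a c)))"
proof -
  have J: "elem_mat t a c \<in> J" "elem_mat t c b \<in> J" "elem_mat t a b \<in> J" for t :: 'r
    using assms by (auto intro!: elem_mat_in_J simp: Phi_def)
  have ne: "a \<noteq> b" "b \<noteq> a" "a \<noteq> c" "c \<noteq> a" "b \<noteq> c" "c \<noteq> b" using assms by auto
  have fin: "finite {v. one_plus (elem_mat t p q) u v \<noteq> 0}" if "elem_mat t p q \<in> J"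
    for t :: 'r and p q u :: 'l
    using one_plus_finite_row[OF that] .
  have "mat_mult (one_plus (elem_mat (r * s) a b)) (one_plus (elem_mat s c b))
      = one_plus (\<lambda>u v. elem_mat (r * s) a b u v + elem_mat s c b u v)"
    using mult_one_plus[OF J(3,2)] ne by (simp add: elem_mat_mult)
  moreover have "(\<lambda>u v. elem_mat (r * s) a b u v + elem_mat s c b u v) \<in> J"
    using J_closed[OF J(3,2)] ne by (simp add: elem_mat_mult)
  \<comment> \<open>Both left summands end in column \<open>b\<close>, while the right factor lives
    in row \<open>a\<close>, and these differ.\<close>
  moreover have "mat_mult (\<lambda>u v. elem_mat (r * s) a b u v + elem_mat s c b u v) (elem_mat r a c)
      = (\<lambda>_ _. 0)"
    using ne by (auto simp: mat_mult_def elem_mat_def fun_eq_iff intro!: sum.neutral)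
  ultimately have "mat_mult (mat_mult (one_plus (elem_mat (r * s) a b)) (one_plus (elem_mat s c b)))
        (one_plus (elem_mat r a c))
      = one_plus (\<lambda>u v. elem_mat (r * s) a b u v + elem_mat s c b u v + elem_mat r a c u v)"
    using J(1) by (simp add: mult_one_plus)
  moreover have "mat_mult (one_plus (elem_mat r a c)) (one_plus (elem_mat s c b))
      = one_plus (\<lambda>u v. elem_mat r a c u v + elem_mat s c b u v + elem_mat (r * s) a b u v)"
    using mult_one_plus[OF J(1,2)] by (simp add: elem_mat_mult)
  ultimately show ?thesis
    by (simp add: mat_mult_assoc fin J add_ac)
qed

text \<open>The whole ring is a nonzero right ideal, so the kernel cannot contain it.\<close>

lemma right_primitive_nontrivial:
  assumes "right_primitive (\<chi> :: 'r::ring_1 \<Rightarrow> 'f::field)"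
  obtains r where "\<chi> r \<noteq> 1"
proof -
  have "right_ideal (UNIV :: 'r set)"
    using group.subgroup_self[OF group_add_group] by (simp add: right_ideal_def)
  moreover have "(UNIV :: 'r set) \<noteq> {0}" by (metis UNIV_I singletonD zero_neq_one)
  ultimately have "\<not> UNIV \<subseteq> kernel add_group mult_group \<chi>"
    using assms unfolding right_primitive_def by blast
  then show ?thesis using that by (auto simp: kernel_def)
qed

lemma extension_imp_derived_disjoint:
  fixes f :: "'l::linorder \<times> 'l \<Rightarrow> 'r::ring_1 \<Rightarrow> 'f::field"
  assumes D: "basic D" and f: "\<forall>d\<in>D. right_primitive (f d)"
    and \<mu>: "\<mu> \<in> hom (McLain\<lparr>carrier := M_of (Gamma1 D)\<rparr>) mult_group"
      "\<forall>h \<in> M_of (Gamma D). \<mu> h = lam D f h"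
  shows "derived_roots (Gamma1 D) \<inter> D = {}"
proof (rule ccontr)
  assume "derived_roots (Gamma1 D) \<inter> D \<noteq> {}"
  then obtain a b where ab: "(a, b) \<in> derived_roots (Gamma1 D)" "(a, b) \<in> D" by auto
  then obtain c where c: "(a, c) \<in> Gamma1 D" "(c, b) \<in> Gamma1 D"
    using derived_roots_closed[OF Gamma1_subset_Phi closed_Gamma1[OF D]] by blast
  have lt: "a < c" "c < b" using c Gamma1_subset_Phi by (auto simp: Phi_def)
  have Phi: "D \<subseteq> Phi" and fin: "finite D" using D by (auto simp: basic_def)
  have hom: "\<forall>d\<in>D. f d \<in> hom add_group mult_group" using f by (simp add: right_primitive_def)
  obtain r where r: "f (a, b) r \<noteq> 1" using f ab right_primitive_nontrivial by blast
  \<comment> \<open>The coefficient 1 in \<open>?y\<close> makes the commutator of \<open>?x\<close>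
    and \<open>?y\<close> exactly \<open>?z\<close>, with the chosen \<open>r\<close>.\<close>
  let ?x = "one_plus (elem_mat r a c)" and ?y = "one_plus (elem_mat (1::'r) c b)"
    and ?z = "one_plus (elem_mat r a b)"
  have root: "one_plus (elem_mat t p q) \<in> M_of \<Delta>" if "(p, q) \<in> \<Delta>"
    for t :: 'r and p q :: 'l and \<Delta>
    using root_in_M_of[OF that] by (auto simp: root_subgroup_def)
  \<comment> \<open>Only roots strictly left of \<open>(a, b)\<close> are removed from row
    \<open>a\<close>. Hence \<open>?z\<close> lies in H, where \<open>\<mu>\<close> is
    known.\<close>
  have "(a, b) \<in> Gamma D"
  proof -
    have "b' = b" if "(a, b') \<in> D" for b'
      using inj_onD[of fst D "(a, b')" "(a, b)"] D ab(2) that by (simp add: basic_def)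
    then have "(a, b) \<notin> row_below d" if "d \<in> D" for d
      using that by (cases d) (auto simp: row_below_def)
    then show ?thesis using ab(2) Phi unfolding Gamma_def by blast
  qed
  then have zH: "?z \<in> M_of (Gamma D)" by (rule root)
  have in_I: "?x \<in> M_of (Gamma1 D)" "?y \<in> M_of (Gamma1 D)" "?z \<in> M_of (Gamma1 D)"
    using root[OF c(1)] root[OF c(2)] subsetD[OF H_subset_I zH] by blast+
  have mult: "\<mu> (mat_mult g h) = \<mu> g * \<mu> h"
    if "g \<in> M_of (Gamma1 D)" "h \<in> M_of (Gamma1 D)" for g h
    using hom_mult[OF \<mu>(1), of g h] that by simp
  have nz: "\<mu> g \<noteq> 0" if "g \<in> M_of (Gamma1 D)" for g
    using hom_in_carrier[OF \<mu>(1), of g] that by simp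
  have "mat_mult ?y ?x \<in> M_of (Gamma1 D)"
    using subgroup.m_closed[OF subgroup_M_of[OF Gamma1_subset_Phi] in_I(2,1)] by simp
  then have "\<mu> ?x * \<mu> ?y = \<mu> ?z * (\<mu> ?y * \<mu> ?x)"
    using commutator_identity[OF lt, of r 1] mult in_I by (metis mult_1_right)
  \<comment> \<open>Commutativity of F lets the nonzero values at \<open>?x\<close> and
    \<open>?y\<close> cancel.\<close>
  then have one: "\<mu> ?z = 1" using nz in_I by (simp add: field_simps)
  \<comment> \<open>The only nonzero off-diagonal entry of \<open>?z\<close> can be at
    \<open>(a, b)\<close>; every other character is evaluated at 0.\<close>
  have entry: "f d (?z (fst d) (snd d)) = (if d = (a, b) then f (a, b) r else 1)"
    if "d \<in> D" for d
    using that Phi hom by (cases d) (auto simp: one_plus_def elem_mat_def Phi_def char_simps)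
  have "\<mu> ?z = (\<Prod>d\<in>D. f d (?z (fst d) (snd d)))"
    using \<mu>(2) zH lam_eq[OF Phi hom] by simp
  also have "\<dots> = f (a, b) r"
    using fin ab(2) by (simp add: entry)
  finally show False using one r by simp
qed

theorem theorem8p14:
  fixes D :: "('l::linorder \<times> 'l) set"
    and f :: "'l \<times> 'l \<Rightarrow> 'r::ring_1 \<Rightarrow> 'f::field"
  assumes "\<exists>\<chi> :: 'r \<Rightarrow> 'f. right_primitive \<chi>"
    and "basic D"
    and "\<forall>d\<in>D. right_primitive (f d)"
  shows "((\<exists>\<mu> \<in> hom (McLain\<lparr>carrier := M_of (Gamma1 D)\<rparr>) mult_group.
             \<forall>h \<in> M_of (Gamma D). \<mu> h = lam D f h)
           \<longleftrightarrow> derived_roots (Gamma1 D) \<inter> D = {})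
       \<and> (derived_roots (Gamma1 D) \<inter> D = {} \<longleftrightarrow> derived_roots (Omega D) \<inter> D = {})
       \<and> (derived_roots (Omega D) \<inter> D = {} \<longleftrightarrow> \<not> special_triple D)"
proof -
  have hom: "\<forall>d\<in>D. f d \<in> hom add_group mult_group"
    using assms(3) by (simp add: right_primitive_def)
  have "derived_roots (Omega D) \<subseteq> derived_roots (Gamma1 D)"
    by (rule derived_roots_mono) (auto simp: Gamma1_def)
  then have "derived_roots (Gamma1 D) \<inter> D = {} \<Longrightarrow> derived_roots (Omega D) \<inter> D = {}"
    by blast
  \<comment> \<open>(a) and (b) imply each other; monotonicity and the two lemmas on triples give
    the cycle (b), (c), (d), (b).\<close>
  then show ?thesis
    using extension_if_derived_disjoint[OF assms(2) hom]
      extension_imp_derived_disjoint[OF assms(2,3)]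
      special_triple_imp_derived_Omega[of D] derived_Gamma1_imp_special_triple[OF assms(2)]
    by blast
qed

end
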